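(* Let $\theta_X$ and $\theta_Y$ be any two formigrams over nonempty finite sets $X$ and $Y$, respectively. Then $$d_{\mathrm{GH}}(\theta_X,\theta_Y)=\frac12\min_R\max_{\substack{(x,y)\in R\\(x',y')\in R}}d_{\mathrm{H}}\left(\theta_X^{-1}(\{x,x'\}^\uparrow),\theta_Y^{-1}(\{y,y'\}^\uparrow)\right),$$ where the minimum is taken over all tripods $R:X\twoheadleftarrow Z\twoheadrightarrow Y$ between $X$ and $Y$.
   Context: A subpartition of a finite set $X$ is a partition (into nonempty disjoint blocks) of some subset of $X$. $\mathbf{SubPart}(X)$ is the lattice of subpartitions ordered by refinement: $P_1\leq P_2$ iff every block of $P_1$ is contained in a block of $P_2$. A formigram over $X$ is a function $\theta:\mathbb{R}\to\mathbf{SubPart}(X)$ for which there is a finite set $\mathbf{crit}(\theta)=\{t_1<\dots<t_n\}\subset\mathbb{R}$ such that, with $t_0=-\infty$, $t_{n+1}=\infty$: (i) $\theta$ is constant on each $(t_i,t_{i+1})$, $i=0,\dots,n$; (ii) for each $t_i\in\mathbf{crit}(\theta)$ and $\varepsilon\in[0,\min(t_i-t_{i-1},t_{i+1}-t_i))$, $\theta(t_i-\varepsilon)\leq\theta(t_i)\geq\theta(t_i+\varepsilon)$. For formigrams $\theta,\theta'$ over the same finite set, $d_{\mathrm{F}}(\theta,\theta')$ is the infimum of $\varepsilon\in[0,\infty)$ such that for all $t\in\mathbb{R}$: $\theta(t)\leq\bigvee_{s\in[t-\varepsilon,t+\varepsilon]}\theta'(s)$ and $\theta'(t)\leq\bigvee_{s\in[t-\varepsilon,t+\varepsilon]}\theta(s)$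 ($\infty$ if there is none). A tripod $R$ between $X$ and $Y$ is a pair of surjections $\varphi_X:Z\twoheadrightarrow X$, $\varphi_Y:Z\twoheadrightarrow Y$ from a finite set $Z$; $(x,y)\in R$ means that there is $z\in Z$ with $\varphi_X(z)=x$, $\varphi_Y(z)=y$. The pullback of $P\in\mathbf{SubPart}(X)$ via $\varphi:Z\twoheadrightarrow X$ is $\varphi^\ast P:=\{\varphi^{-1}(B):B\in P\}$, and the pullback of a formigram is $(\varphi^\ast\theta_X)(t):=\varphi^\ast(\theta_X(t))$. The Gromov-Hausdorff distance between formigrams is $d_{\mathrm{GH}}(\theta_X,\theta_Y):=\frac12\min_R d_{\mathrm{F}}(\varphi_X^\ast\theta_X,\varphi_Y^\ast\theta_Y)$, minimum over all tripods. $\mathbf{Int}:=\{(a,b)\in\mathbb{R}^2:a\leq b\}$, where $(a,b)$ is identified with the closed interval $[a,b]$ and the order is inclusion of intervals. A formigram $\theta$ over $X$ is identified with the order-preserving map $\widehat{\theta}:\mathbf{Int}\to\mathbf{SubPart}(X)$, $I\mapsto\bigvee_{s\in I}\theta(s)$, and $\theta^{-1}(\{x,x'\}^\uparrow)$ denotes the set of $I\in\mathbf{Int}$ such that $x$ and $x'$ lie in a common block of $\widehat{\theta}(I)$ (if $x=x'$: such that $x$ lies in some block). $d_{\mathrm{H}}$ is the Hausdorff distance in $(\mathbf{Int},\|\cdot\|_\infty)$: $d_{\mathrm{H}}(A,B):=\inf\{\varepsilon\in[0,\infty):A\subset B^\varepsilon,\ B\subset A^\varepsilon\}$ ($\inf\emptyset=\infty$),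 where $A^\varepsilon:=\{x\in\mathbf{Int}:\exists a\in A,\ \|a-x\|_\infty\leq\varepsilon\}$. *)

theory Defs
  imports "HOL-Algebra.Lattice" "HOL-Analysis.Analysis" "HOL-Library.Disjoint_Sets"
begin

definition SubPart :: "'a set \<Rightarrow> 'a set set gorder" where
  "SubPart X = \<lparr> carrier = {P. \<exists>A\<subseteq>X. partition_on A P}, eq = (=),
                le = (\<lambda>P Q. \<forall>B\<in>P. \<exists>C\<in>Q. B \<subseteq> C) \<rparr>"

text \<open>
  The critical points are \<open>t 1 < \<dots> < t n\<close>, all of them finite because they lie strictly
  between \<open>t 0 = -\<infinity>\<close> and \<open>t (n + 1) = \<infinity>\<close>; \<open>n = 0\<close> is allowed.
\<close>

definition formigram :: "'a set \<Rightarrow> (real \<Rightarrow> 'a set set) \<Rightarrow> bool" where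
  "formigram X \<theta> \<longleftrightarrow>
     (\<forall>s. \<theta> s \<in> carrier (SubPart X)) \<and>
     (\<exists>(n::nat) (t :: nat \<Rightarrow> ereal).
        t 0 = -\<infinity> \<and> t (n + 1) = \<infinity> \<and> (\<forall>i\<le>n. t i < t (i + 1)) \<and>
        (\<forall>i\<le>n. \<forall>r s. t i < ereal r \<and> ereal r < t (i + 1) \<and> t i < ereal s \<and> ereal s < t (i + 1)
           \<longrightarrow> \<theta> r = \<theta> s) \<and>
        (\<forall>i\<in>{1..n}. \<forall>c \<epsilon>. t i = ereal c \<and> 0 \<le> \<epsilon> \<and>
             ereal \<epsilon> < min (t i - t (i - 1)) (t (i + 1) - t i)
           \<longrightarrow> \<theta> (c - \<epsilon>) \<sqsubseteq>\<^bsub>SubPart X\<^esub> \<theta> c \<and> \<theta> (c + \<epsilon>) \<sqsubseteq>\<^bsub>SubPart X\<^esub> \<theta> c))"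

definition dF :: "'a set \<Rightarrow> (real \<Rightarrow> 'a set set) \<Rightarrow> (real \<Rightarrow> 'a set set) \<Rightarrow> ereal" where
  "dF X \<theta> \<theta>' = Inf {ereal \<epsilon> | \<epsilon>. 0 \<le> \<epsilon> \<and>
     (\<forall>t. \<theta> t \<sqsubseteq>\<^bsub>SubPart X\<^esub> \<Squnion>\<^bsub>SubPart X\<^esub> (\<theta>' ` {t - \<epsilon>..t + \<epsilon>}) \<and>
          \<theta>' t \<sqsubseteq>\<^bsub>SubPart X\<^esub> \<Squnion>\<^bsub>SubPart X\<^esub> (\<theta> ` {t - \<epsilon>..t + \<epsilon>}))}"

text \<open>
  The apex \<open>Z\<close> ranges over the finite sets of natural numbers, hence over all finite sets up to
  bijection. The maps are total functions, of which only the restriction to \<open>Z\<close> matters.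
\<close>

definition tripod :: "'a set \<Rightarrow> 'b set \<Rightarrow> nat set \<Rightarrow> (nat \<Rightarrow> 'a) \<Rightarrow> (nat \<Rightarrow> 'b) \<Rightarrow> bool" where
  "tripod X Y Z \<phi> \<psi> \<longleftrightarrow> finite Z \<and> \<phi> ` Z = X \<and> \<psi> ` Z = Y"

definition tripod_rel :: "nat set \<Rightarrow> (nat \<Rightarrow> 'a) \<Rightarrow> (nat \<Rightarrow> 'b) \<Rightarrow> ('a \<times> 'b) set" where
  "tripod_rel Z \<phi> \<psi> = {(x, y). \<exists>z\<in>Z. \<phi> z = x \<and> \<psi> z = y}"

definition pullback :: "'z set \<Rightarrow> ('z \<Rightarrow> 'a) \<Rightarrow> 'a set set \<Rightarrow> 'z set set" where
  "pullback Z \<phi> P = {\<phi> -` B \<inter> Z | B. B \<in> P}"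

definition GH_values ::
    "'a set \<Rightarrow> (real \<Rightarrow> 'a set set) \<Rightarrow> 'b set \<Rightarrow> (real \<Rightarrow> 'b set set) \<Rightarrow> ereal set" where
  "GH_values X \<theta>X Y \<theta>Y =
     {dF Z (\<lambda>t. pullback Z \<phi> (\<theta>X t)) (\<lambda>t. pullback Z \<psi> (\<theta>Y t)) | Z \<phi> \<psi>. tripod X Y Z \<phi> \<psi>}"

definition dGH ::
    "'a set \<Rightarrow> (real \<Rightarrow> 'a set set) \<Rightarrow> 'b set \<Rightarrow> (real \<Rightarrow> 'b set set) \<Rightarrow> ereal" where
  "dGH X \<theta>X Y \<theta>Y = 1 / 2 * (LEAST d. d \<in> GH_values X \<theta>X Y \<theta>Y)"

text \<open>The pair \<open>(a, b)\<close> stands for the closed interval \<open>{a..b}\<close>.\<close>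

definition Int_pairs :: "(real \<times> real) set" where
  "Int_pairs = {(a, b). a \<le> b}"

definition formigram_hat :: "'a set \<Rightarrow> (real \<Rightarrow> 'a set set) \<Rightarrow> real \<times> real \<Rightarrow> 'a set set" where
  "formigram_hat X \<theta> = (\<lambda>(a, b). \<Squnion>\<^bsub>SubPart X\<^esub> (\<theta> ` {a..b}))"

text \<open>
  The preimage of the up-set of the subpartition \<open>{{x, x'}}\<close> under \<open>formigram_hat X \<theta>\<close>;
  \<open>x = x'\<close> is allowed.
\<close>

definition preimage_up ::
    "'a set \<Rightarrow> (real \<Rightarrow> 'a set set) \<Rightarrow> 'a \<Rightarrow> 'a \<Rightarrow> (real \<times> real) set" where
  "preimage_up X \<theta> x x' = {I \<in> Int_pairs. \<exists>B \<in> formigram_hat X \<theta> I. {x, x'} \<subseteq> B}"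

definition thicken :: "(real \<times> real) set \<Rightarrow> real \<Rightarrow> (real \<times> real) set" where
  "thicken A \<epsilon> = {I \<in> Int_pairs. \<exists>a\<in>A. infnorm (a - I) \<le> \<epsilon>}"

definition dH :: "(real \<times> real) set \<Rightarrow> (real \<times> real) set \<Rightarrow> ereal" where
  "dH A B = Inf {ereal \<epsilon> | \<epsilon>. 0 \<le> \<epsilon> \<and> A \<subseteq> thicken B \<epsilon> \<and> B \<subseteq> thicken A \<epsilon>}"

text \<open>
  The values \<open>max d\<^sub>H(\<dots>)\<close> of the individual tripods; for nonempty finite sets \<open>X\<close> and \<open>Y\<close>
  each maximum is over a nonempty finite set.
\<close>

definition max_dH_values ::
    "'a set \<Rightarrow> (real \<Rightarrow> 'a set set) \<Rightarrow> 'b set \<Rightarrow> (real \<Rightarrow> 'b set set) \<Rightarrow> ereal set" where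
  "max_dH_values X \<theta>X Y \<theta>Y =
     {Max {dH (preimage_up X \<theta>X x x') (preimage_up Y \<theta>Y y y') | x y x' y'.
             (x, y) \<in> tripod_rel Z \<phi> \<psi> \<and> (x', y') \<in> tripod_rel Z \<phi> \<psi>}
      | Z \<phi> \<psi>. tripod X Y Z \<phi> \<psi>}"

end

theory Submission
  imports Defs
begin

text \<open>
  Every tripod contributes the same number to both sides, so the two minima range over the same
  set of values.

  A subpartition is encoded faithfully by the relation ``lie in a common block'', a symmetric and
  transitive relation that is reflexive on its support only. Under this encoding refinement is
  inclusion, a join is the transitive closure of a union, and a pullback is an inverse image
  (\<open>subpart_le_iff\<close>, \<open>same_block_join\<close>, \<open>same_block_pullback\<close>). Inverse images under a surjection
  commute with transitive closures (\<open>pull_rel_trancl\<close>), so for a formigram all the joins that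
  occur on the apex \<open>Z\<close> are inverse images of the relations \<open>joined \<theta> a b\<close>, where
  \<open>(x, x') \<in> joined \<theta> a b\<close> says that \<open>(a, b)\<close> belongs to the preimage of the up-set of \<open>{x, x'}\<close>.

  Both distances now speak about the implication
  \<open>(x, x') \<in> joined \<theta> a b \<Longrightarrow> (y, y') \<in> joined \<theta>' (a - \<epsilon>) (b + \<epsilon>)\<close>.
  For fixed \<open>x, x', y, y'\<close> and all \<open>a \<le> b\<close> this is the inclusion of one preimage in the
  \<open>\<epsilon>\<close>-thickening of the other: preimages are closed under enlarging intervals, and
  \<open>(a - \<epsilon>, b + \<epsilon>)\<close> is the largest interval within distance \<open>\<epsilon>\<close> of \<open>(a, b)\<close>. The condition that
  defines \<open>dF\<close> is this implication, in both directions and for all pairs of points of the apex, on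
  the degenerate intervals \<open>a = b\<close>; joining over the points of an interval extends it to all
  intervals. Hence the parameters admissible for \<open>dF\<close> are those admissible for \<open>dH\<close> at all of these
  finitely many pairs. Admissible parameters form up-closed sets, and for these the infimum of a
  finite intersection is the maximum of the infima (\<open>Inf_Inter_upclosed\<close>).

  The minima exist because the maximum attached to a tripod depends only on its relation, a subset
  of the finite set \<open>X \<times> Y\<close>.
\<close>

section \<open>Subpartitions as relations\<close>

definition same_block :: "'a set set \<Rightarrow> ('a \<times> 'a) set" where
  "same_block P = {(x, y). \<exists>B\<in>P. x \<in> B \<and> y \<in> B}"

lemma carrier_SubPartD:
  assumes "P \<in> carrier (SubPart X)"
  shows "\<Union>P \<subseteq> X" "{} \<notin> P" "\<And>B C x. B \<in> P \<Longrightarrow> C \<in> P \<Longrightarrow> x \<in> B \<Longrightarrow> x \<in> C \<Longrightarrow> B = C"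
  using assms by (auto simp: SubPart_def partition_on_def disjoint_def)

lemma same_block_subset: "P \<in> carrier (SubPart X) \<Longrightarrow> same_block P \<subseteq> X \<times> X"
  using carrier_SubPartD(1)[of P X] by (auto simp: same_block_def)

text \<open>
  From right to left, a block of \<open>P\<close> has an element since it is nonempty, and the block of \<open>Q\<close>
  around that element is unique since blocks are disjoint.
\<close>

lemma subpart_le_iff:
  assumes P: "P \<in> carrier (SubPart X)" and Q: "Q \<in> carrier (SubPart X)"
  shows "P \<sqsubseteq>\<^bsub>SubPart X\<^esub> Q \<longleftrightarrow> same_block P \<subseteq> same_block Q"
proof
  assume "P \<sqsubseteq>\<^bsub>SubPart X\<^esub> Q"
  then have le: "\<forall>B\<in>P. \<exists>C\<in>Q. B \<subseteq> C"
    by (simp add: SubPart_def)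
  show "same_block P \<subseteq> same_block Q"
  proof (rule subrelI)
    fix x y assume "(x, y) \<in> same_block P"
    then obtain B where B: "B \<in> P" "x \<in> B" "y \<in> B"
      by (auto simp: same_block_def)
    with le obtain C where "C \<in> Q" "B \<subseteq> C" by metis
    with B show "(x, y) \<in> same_block Q"
      by (auto simp: same_block_def)
  qed
next
  assume sub: "same_block P \<subseteq> same_block Q"
  have "\<exists>C\<in>Q. B \<subseteq> C" if B: "B \<in> P" for B
  proof -
    obtain x where x: "x \<in> B"
      using carrier_SubPartD(2)[OF P] B by (metis ex_in_conv)
    have rel: "(x, y) \<in> same_block Q" if "y \<in> B" for y
      using sub B x that by (auto simp: same_block_def)
    from rel[OF x] obtain C where C: "C \<in> Q" "x \<in> C"
      by (auto simp: same_block_def)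
    have "B \<subseteq> C"
    proof
      fix y assume "y \<in> B"
      from rel[OF this] obtain D where "D \<in> Q" "x \<in> D" "y \<in> D"
        by (auto simp: same_block_def)
      then show "y \<in> C"
        using carrier_SubPartD(3)[OF Q C(1) \<open>D \<in> Q\<close> C(2) \<open>x \<in> D\<close>] by simp
    qed
    with C show ?thesis by blast
  qed
  then show "P \<sqsubseteq>\<^bsub>SubPart X\<^esub> Q"
    by (simp add: SubPart_def)
qed

lemma same_block_quotient:
  assumes "equiv A r"
  shows "same_block (A // r) = r"
proof -
  have "(x, y) \<in> r" if "(x, y) \<in> same_block (A // r)" for x y
    using that assms unfolding same_block_def by (auto dest: quotient_eq_iff)
  moreover have "(x, y) \<in> same_block (A // r)" if xy: "(x, y) \<in> r" for x y
  proof -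
    have "x \<in> A"
      using xy assms by (auto simp: equiv_def)
    moreover from this have "x \<in> r `` {x}"
      using assms equiv_class_self by fast
    ultimately show ?thesis
      using xy by (auto simp: same_block_def intro!: bexI[of _ "r `` {x}"] quotientI)
  qed
  ultimately show ?thesis by auto
qed

lemma trans_same_block: "P \<in> carrier (SubPart X) \<Longrightarrow> trans (same_block P)"
  using carrier_SubPartD(3)[of P X] unfolding same_block_def trans_def by auto

text \<open>
  The classes of the transitive closure form a least upper bound. The supremum is a choice among
  least upper bounds; any two of them refine each other and so have the same common-block relation.
\<close>

lemma same_block_join:
  assumes F: "F \<subseteq> carrier (SubPart X)"
  shows "\<Squnion>\<^bsub>SubPart X\<^esub> F \<in> carrier (SubPart X)"
    and "same_block (\<Squnion>\<^bsub>SubPart X\<^esub> F) = (\<Union>P\<in>F. same_block P)\<^sup>+"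
proof -
  define r where "r = (\<Union>P\<in>F. same_block P)\<^sup>+"
  define A where "A = \<Union>(\<Union>F)"
  define J where "J = A // r"
  have "(\<Union>P\<in>F. same_block P) \<subseteq> A \<times> A"
    by (auto simp: same_block_def A_def)
  then have rA: "r \<subseteq> A \<times> A"
    unfolding r_def by (rule trancl_subset_Sigma)
  have "(x, x) \<in> (\<Union>P\<in>F. same_block P)" if "x \<in> A" for x
    using that by (auto simp: same_block_def A_def)
  then have "refl_on A r"
    unfolding r_def by (intro refl_onI r_into_trancl)
  moreover have "sym r"
    unfolding r_def by (intro sym_trancl) (auto simp: same_block_def sym_def)
  ultimately have eqv: "equiv A r"
    using rA by (auto simp: equiv_def r_def)
  have AX: "A \<subseteq> X"
    using carrier_SubPartD(1) F unfolding A_def by blast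
  have J: "J \<in> carrier (SubPart X)"
    using partition_on_quotient[OF eqv] AX by (auto simp: SubPart_def J_def)
  have sJ: "same_block J = r"
    using same_block_quotient[OF eqv] by (simp add: J_def)
  have upper: "Q \<in> Upper (SubPart X) F \<longleftrightarrow> Q \<in> carrier (SubPart X) \<and> r \<subseteq> same_block Q" for Q
  proof -
    have "(\<forall>P\<in>F. same_block P \<subseteq> same_block Q) \<longleftrightarrow> r \<subseteq> same_block Q"
      if Q: "Q \<in> carrier (SubPart X)"
    proof
      assume "\<forall>P\<in>F. same_block P \<subseteq> same_block Q"
      then have "(\<Union>P\<in>F. same_block P) \<subseteq> same_block Q" by blast
      then have "r \<subseteq> (same_block Q)\<^sup>+"
        unfolding r_def by (intro subrelI) (rule trancl_mono)
      then show "r \<subseteq> same_block Q"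
        using trans_same_block[OF Q] by simp
    next
      assume "r \<subseteq> same_block Q"
      moreover have "same_block P \<subseteq> r" if "P \<in> F" for P
        using that unfolding r_def by (intro subrelI r_into_trancl) auto
      ultimately show "\<forall>P\<in>F. same_block P \<subseteq> same_block Q"
        by (meson subset_trans)
    qed
    then show ?thesis
      using F subpart_le_iff[of _ X Q] unfolding Upper_def by (auto 0 3)
  qed
  have "least (SubPart X) J (Upper (SubPart X) F)"
    using J upper sJ subpart_le_iff[OF J] by (auto simp: least_def)
  then have lub: "least (SubPart X) (\<Squnion>\<^bsub>SubPart X\<^esub> F) (Upper (SubPart X) F)"
    unfolding sup_def by (rule someI)
  then show S: "\<Squnion>\<^bsub>SubPart X\<^esub> F \<in> carrier (SubPart X)"
    by (simp add: least_def upper)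
  have "J \<in> Upper (SubPart X) F"
    by (simp add: upper J sJ)
  then have "\<Squnion>\<^bsub>SubPart X\<^esub> F \<sqsubseteq>\<^bsub>SubPart X\<^esub> J" and "r \<subseteq> same_block (\<Squnion>\<^bsub>SubPart X\<^esub> F)"
    using lub by (auto simp: least_def upper)
  then show "same_block (\<Squnion>\<^bsub>SubPart X\<^esub> F) = (\<Union>P\<in>F. same_block P)\<^sup>+"
    using subpart_le_iff[OF S J] sJ r_def by auto
qed

section \<open>Pullbacks\<close>

definition pull_rel :: "'z set \<Rightarrow> ('z \<Rightarrow> 'a) \<Rightarrow> ('a \<times> 'a) set \<Rightarrow> ('z \<times> 'z) set" where
  "pull_rel Z \<phi> r = {(z, w). z \<in> Z \<and> w \<in> Z \<and> (\<phi> z, \<phi> w) \<in> r}"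

lemma same_block_pullback: "same_block (pullback Z \<phi> P) = pull_rel Z \<phi> (same_block P)"
  by (auto simp: same_block_def pullback_def pull_rel_def)

text \<open>Surjectivity keeps the preimages of the blocks nonempty.\<close>

lemma pullback_in_carrier:
  assumes P: "P \<in> carrier (SubPart X)" and surj: "\<phi> ` Z = X"
  shows "pullback Z \<phi> P \<in> carrier (SubPart Z)"
proof -
  have "{} \<notin> pullback Z \<phi> P"
  proof
    assume "{} \<in> pullback Z \<phi> P"
    then obtain B where B: "B \<in> P" "\<phi> -` B \<inter> Z = {}"
      by (auto simp: pullback_def)
    obtain x where "x \<in> B" "x \<in> X"
      using B carrier_SubPartD(1,2)[OF P] by (metis UnionI ex_in_conv subsetD)
    then show False
      using B surj by blast
  qed
  moreover have "disjoint (pullback Z \<phi> P)"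
    using carrier_SubPartD(3)[OF P] by (fastforce simp: disjoint_def pullback_def)
  moreover have "\<Union>(pullback Z \<phi> P) \<subseteq> Z"
    by (auto simp: pullback_def)
  ultimately show ?thesis
    by (auto simp: SubPart_def partition_on_def)
qed

text \<open>
  A chain in \<open>\<phi> ` Z\<close> lifts to \<open>Z\<close> because each intermediate point has a preimage.
\<close>

lemma pull_rel_trancl:
  assumes r: "r \<subseteq> \<phi> ` Z \<times> \<phi> ` Z"
  shows "(pull_rel Z \<phi> r)\<^sup>+ = pull_rel Z \<phi> (r\<^sup>+)"
proof (intro equalityI subrelI)
  fix z w assume "(z, w) \<in> (pull_rel Z \<phi> r)\<^sup>+"
  then show "(z, w) \<in> pull_rel Z \<phi> (r\<^sup>+)"
    by induction (auto simp: pull_rel_def intro: trancl_into_trancl)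
next
  have lift: "\<forall>w\<in>Z. \<phi> w = y \<longrightarrow> (z, w) \<in> (pull_rel Z \<phi> r)\<^sup>+"
    if "(x, y) \<in> r\<^sup>+" "z \<in> Z" "\<phi> z = x" for x y z
    using that
  proof induction
    case (base y)
    then show ?case by (auto simp: pull_rel_def)
  next
    case (step y y')
    from step.hyps r obtain v where v: "v \<in> Z" "\<phi> v = y"
      by blast
    then have "(z, v) \<in> (pull_rel Z \<phi> r)\<^sup>+"
      using step by blast
    moreover have "(v, w) \<in> pull_rel Z \<phi> r" if "w \<in> Z" "\<phi> w = y'" for w
      using v that step.hyps by (auto simp: pull_rel_def)
    ultimately show ?case
      by (meson trancl_into_trancl)
  qed
  fix z w assume "(z, w) \<in> pull_rel Z \<phi> (r\<^sup>+)"
  then show "(z, w) \<in> (pull_rel Z \<phi> r)\<^sup>+"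
    using lift by (auto simp: pull_rel_def)
qed

section \<open>Joins over intervals and thickenings\<close>

definition joined :: "(real \<Rightarrow> 'a set set) \<Rightarrow> real \<Rightarrow> real \<Rightarrow> ('a \<times> 'a) set" where
  "joined \<theta> a b = (\<Union>s\<in>{a..b}. same_block (\<theta> s))\<^sup>+"

lemma joined_mono:
  assumes "(x, y) \<in> joined \<theta> a b" "c \<le> a" "b \<le> d"
  shows "(x, y) \<in> joined \<theta> c d"
proof -
  have "(\<Union>s\<in>{a..b}. same_block (\<theta> s)) \<subseteq> (\<Union>s\<in>{c..d}. same_block (\<theta> s))"
    using assms by (intro UN_mono) auto
  then show ?thesis
    using assms(1) unfolding joined_def by (rule trancl_mono[rotated])
qed

lemma preimage_up_iff:
  assumes "\<And>s. \<theta> s \<in> carrier (SubPart X)"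
  shows "(a, b) \<in> preimage_up X \<theta> x x' \<longleftrightarrow> a \<le> b \<and> (x, x') \<in> joined \<theta> a b"
proof -
  have "\<theta> ` {a..b} \<subseteq> carrier (SubPart X)"
    using assms by auto
  from same_block_join(2)[OF this] have "same_block (formigram_hat X \<theta> (a, b)) = joined \<theta> a b"
    by (simp add: formigram_hat_def joined_def image_image)
  moreover have "(\<exists>B\<in>formigram_hat X \<theta> (a, b). {x, x'} \<subseteq> B) \<longleftrightarrow>
      (x, x') \<in> same_block (formigram_hat X \<theta> (a, b))"
    by (auto simp: same_block_def)
  ultimately show ?thesis
    by (simp add: preimage_up_def Int_pairs_def)
qed

text \<open>
  For \<open>\<epsilon> \<ge> 0\<close> this is the inclusion of the preimage for \<open>{x, x'}\<close> in the \<open>\<epsilon>\<close>-thickening of the one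
  for \<open>{y, y'}\<close>, in a form without thickenings (\<open>preimage_up_subset_thicken_iff\<close>).
\<close>

definition carried ::
    "(real \<Rightarrow> 'a set set) \<Rightarrow> 'a \<Rightarrow> 'a \<Rightarrow> (real \<Rightarrow> 'b set set) \<Rightarrow> 'b \<Rightarrow> 'b \<Rightarrow> real \<Rightarrow> bool" where
  "carried \<theta> x x' \<theta>' y y' \<epsilon> \<longleftrightarrow>
     (\<forall>a b. a \<le> b \<longrightarrow> (x, x') \<in> joined \<theta> a b \<longrightarrow> (y, y') \<in> joined \<theta>' (a - \<epsilon>) (b + \<epsilon>))"

lemma carried_mono: "carried \<theta> x x' \<theta>' y y' \<epsilon> \<Longrightarrow> \<epsilon> \<le> \<delta> \<Longrightarrow> carried \<theta> x x' \<theta>' y y' \<delta>"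
  unfolding carried_def by (meson add_left_mono diff_left_mono joined_mono)

lemma infnorm_real_prod: "infnorm ((a, b) :: real \<times> real) = max \<bar>a\<bar> \<bar>b\<bar>"
  by (simp add: infnorm_Max Basis_prod_def image_Un image_image)

text \<open>
  All intervals within distance \<open>\<epsilon>\<close> of \<open>(a, b)\<close> are contained in \<open>(a - \<epsilon>, b + \<epsilon>)\<close>, and preimages
  are closed under enlarging intervals; so it suffices to test this largest interval.
\<close>

lemma preimage_up_subset_thicken_iff:
  assumes \<theta>: "\<And>s. \<theta> s \<in> carrier (SubPart X)" and \<theta>': "\<And>s. \<theta>' s \<in> carrier (SubPart Y)"
    and \<epsilon>: "0 \<le> \<epsilon>"
  shows "preimage_up X \<theta> x x' \<subseteq> thicken (preimage_up Y \<theta>' y y') \<epsilon> \<longleftrightarrow>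
         carried \<theta> x x' \<theta>' y y' \<epsilon>"
proof
  assume sub: "preimage_up X \<theta> x x' \<subseteq> thicken (preimage_up Y \<theta>' y y') \<epsilon>"
  show "carried \<theta> x x' \<theta>' y y' \<epsilon>"
    unfolding carried_def
  proof (intro allI impI)
    fix a b :: real assume "a \<le> b" "(x, x') \<in> joined \<theta> a b"
    then have "(a, b) \<in> thicken (preimage_up Y \<theta>' y y') \<epsilon>"
      using sub preimage_up_iff[of \<theta> X, OF \<theta>] by blast
    then obtain c d where cd: "(c, d) \<in> preimage_up Y \<theta>' y y'" "infnorm ((c, d) - (a, b)) \<le> \<epsilon>"
      by (auto simp: thicken_def)
    then have "a - \<epsilon> \<le> c" "d \<le> b + \<epsilon>"
      by (auto simp: infnorm_real_prod)
    with cd(1) show "(y, y') \<in> joined \<theta>' (a - \<epsilon>) (b + \<epsilon>)"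
      using preimage_up_iff[of \<theta>' Y, OF \<theta>'] joined_mono by metis
  qed
next
  assume c: "carried \<theta> x x' \<theta>' y y' \<epsilon>"
  show "preimage_up X \<theta> x x' \<subseteq> thicken (preimage_up Y \<theta>' y y') \<epsilon>"
  proof
    fix I assume I: "I \<in> preimage_up X \<theta> x x'"
    obtain a b where ab: "I = (a, b)" by force
    have "a \<le> b" "(x, x') \<in> joined \<theta> a b"
      using I preimage_up_iff[of \<theta> X, OF \<theta>] by (auto simp: ab)
    then have "(a - \<epsilon>, b + \<epsilon>) \<in> preimage_up Y \<theta>' y y'"
      using c \<epsilon> preimage_up_iff[of \<theta>' Y, OF \<theta>'] by (simp add: carried_def)
    moreover have "infnorm ((a - \<epsilon>, b + \<epsilon>) - I) \<le> \<epsilon>"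
      using \<epsilon> by (simp add: ab infnorm_real_prod)
    moreover have "I \<in> Int_pairs"
      using \<open>a \<le> b\<close> by (simp add: ab Int_pairs_def)
    ultimately show "I \<in> thicken (preimage_up Y \<theta>' y y') \<epsilon>"
      unfolding thicken_def by blast
  qed
qed

lemma pull_rel_joined:
  assumes \<theta>: "\<And>s. \<theta> s \<in> carrier (SubPart X)" and \<phi>: "\<phi> ` Z = X"
  shows "(\<Union>s\<in>{a..b}. pull_rel Z \<phi> (same_block (\<theta> s)))\<^sup>+ = pull_rel Z \<phi> (joined \<theta> a b)"
proof -
  have "(\<Union>s\<in>{a..b}. pull_rel Z \<phi> (same_block (\<theta> s))) =
      pull_rel Z \<phi> (\<Union>s\<in>{a..b}. same_block (\<theta> s))"
    by (auto simp: pull_rel_def)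
  moreover have "(\<Union>s\<in>{a..b}. same_block (\<theta> s)) \<subseteq> \<phi> ` Z \<times> \<phi> ` Z"
    unfolding \<phi> by (intro UN_least same_block_subset \<theta>)
  ultimately show ?thesis
    by (simp add: pull_rel_trancl joined_def)
qed

text \<open>
  The left-hand side concerns single times, the right-hand side all intervals. To pass from times
  to an interval \<open>(a, b)\<close>, note that the pullback of \<open>joined \<theta>' (a - \<epsilon>) (b + \<epsilon>)\<close> contains the
  relations of all times in the interval; being transitive, it contains the transitive closure of
  their union as well.
\<close>

lemma pullback_le_join_iff_carried:
  assumes \<theta>: "\<And>s. \<theta> s \<in> carrier (SubPart X)" and \<theta>': "\<And>s. \<theta>' s \<in> carrier (SubPart Y)"
    and \<phi>: "\<phi> ` Z = X" and \<psi>: "\<psi> ` Z = Y"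
  shows "(\<forall>t. pullback Z \<phi> (\<theta> t) \<sqsubseteq>\<^bsub>SubPart Z\<^esub>
             \<Squnion>\<^bsub>SubPart Z\<^esub> ((\<lambda>s. pullback Z \<psi> (\<theta>' s)) ` {t - \<epsilon>..t + \<epsilon>})) \<longleftrightarrow>
         (\<forall>z\<in>Z. \<forall>w\<in>Z. carried \<theta> (\<phi> z) (\<phi> w) \<theta>' (\<psi> z) (\<psi> w) \<epsilon>)"
proof -
  have "pullback Z \<phi> (\<theta> t) \<sqsubseteq>\<^bsub>SubPart Z\<^esub>
          \<Squnion>\<^bsub>SubPart Z\<^esub> ((\<lambda>s. pullback Z \<psi> (\<theta>' s)) ` {t - \<epsilon>..t + \<epsilon>}) \<longleftrightarrow>
        pull_rel Z \<phi> (same_block (\<theta> t)) \<subseteq> pull_rel Z \<psi> (joined \<theta>' (t - \<epsilon>) (t + \<epsilon>))" for t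
  proof -
    have F: "(\<lambda>s. pullback Z \<psi> (\<theta>' s)) ` {t - \<epsilon>..t + \<epsilon>} \<subseteq> carrier (SubPart Z)"
      using pullback_in_carrier[OF \<theta>' \<psi>] by auto
    show ?thesis
      using subpart_le_iff[OF pullback_in_carrier[OF \<theta> \<phi>] same_block_join(1)[OF F]]
        same_block_join(2)[OF F] pull_rel_joined[OF \<theta>' \<psi>]
      by (simp add: same_block_pullback)
  qed
  moreover have "(\<forall>t. pull_rel Z \<phi> (same_block (\<theta> t)) \<subseteq>
                       pull_rel Z \<psi> (joined \<theta>' (t - \<epsilon>) (t + \<epsilon>))) \<longleftrightarrow>
        (\<forall>z\<in>Z. \<forall>w\<in>Z. carried \<theta> (\<phi> z) (\<phi> w) \<theta>' (\<psi> z) (\<psi> w) \<epsilon>)" (is "?pt \<longleftrightarrow> ?int")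
  proof
    assume ?pt
    show ?int
      unfolding carried_def
    proof (intro ballI allI impI)
      fix z w a b assume zw: "z \<in> Z" "w \<in> Z" and "a \<le> b" and ab: "(\<phi> z, \<phi> w) \<in> joined \<theta> a b"
      let ?r = "pull_rel Z \<psi> (joined \<theta>' (a - \<epsilon>) (b + \<epsilon>))"
      have "(\<Union>s\<in>{a..b}. pull_rel Z \<phi> (same_block (\<theta> s))) \<subseteq> ?r"
      proof (rule UN_least, rule subrelI)
        fix s u v assume "s \<in> {a..b}" "(u, v) \<in> pull_rel Z \<phi> (same_block (\<theta> s))"
        with \<open>?pt\<close> have "(u, v) \<in> pull_rel Z \<psi> (joined \<theta>' (s - \<epsilon>) (s + \<epsilon>))"
          by blast
        with \<open>s \<in> {a..b}\<close> show "(u, v) \<in> ?r"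
          by (auto simp: pull_rel_def intro: joined_mono)
      qed
      moreover have "trans ?r"
        by (auto simp: trans_def pull_rel_def joined_def intro: trancl_trans)
      ultimately have "(\<Union>s\<in>{a..b}. pull_rel Z \<phi> (same_block (\<theta> s)))\<^sup>+ \<subseteq> ?r"
        by (metis subrelI trancl_id trancl_mono)
      then have "pull_rel Z \<phi> (joined \<theta> a b) \<subseteq> ?r"
        by (simp only: pull_rel_joined[OF \<theta> \<phi>])
      with zw ab show "(\<psi> z, \<psi> w) \<in> joined \<theta>' (a - \<epsilon>) (b + \<epsilon>)"
        by (auto simp: pull_rel_def)
    qed
  next
    assume ?int
    show ?pt
    proof (intro allI subrelI)
      fix t z w assume "(z, w) \<in> pull_rel Z \<phi> (same_block (\<theta> t))"
      then have "z \<in> Z" "w \<in> Z" "(\<phi> z, \<phi> w) \<in> joined \<theta> t t"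
        by (auto simp: pull_rel_def joined_def)
      with \<open>?int\<close> show "(z, w) \<in> pull_rel Z \<psi> (joined \<theta>' (t - \<epsilon>) (t + \<epsilon>))"
        by (simp add: pull_rel_def carried_def)
    qed
  qed
  ultimately show ?thesis by simp
qed

section \<open>The two distances of a tripod\<close>

text \<open>
  Parameters admissible for the single indices and below a given bound have a common majorant below
  that bound, because there are finitely many of them; up-closure makes it admissible for all
  indices.
\<close>

lemma Inf_Inter_upclosed:
  fixes S :: "'i \<Rightarrow> real set"
  assumes fin: "finite I" and ne: "I \<noteq> {}"
    and up: "\<And>i \<epsilon> \<delta>. i \<in> I \<Longrightarrow> \<epsilon> \<in> S i \<Longrightarrow> \<epsilon> \<le> \<delta> \<Longrightarrow> \<delta> \<in> S i"
  shows "Inf (ereal ` (\<Inter>i\<in>I. S i)) = Max ((\<lambda>i. Inf (ereal ` S i)) ` I)" (is "?L = ?M")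
proof (rule antisym)
  have "Inf (ereal ` S i) \<le> ?L" if "i \<in> I" for i
    using that by (intro Inf_superset_mono image_mono) auto
  then show "?M \<le> ?L"
    using fin ne by simp
  show "?L \<le> ?M"
  proof (rule dense_ge)
    fix d assume d: "?M < d"
    have "\<exists>\<epsilon>\<in>S i. ereal \<epsilon> < d" if "i \<in> I" for i
    proof -
      have "Inf (ereal ` S i) < d"
        using d fin that by (meson Max_ge finite_imageI imageI le_less_trans)
      then show ?thesis by (auto simp: Inf_less_iff)
    qed
    then obtain e where e: "\<And>i. i \<in> I \<Longrightarrow> e i \<in> S i \<and> ereal (e i) < d"
      by metis
    have "Max (e ` I) \<in> e ` I"
      using fin ne by (intro Max_in) auto
    then have "ereal (Max (e ` I)) < d"
      using e by auto
    moreover have "Max (e ` I) \<in> S i" if "i \<in> I" for i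
      using up[of i "e i" "Max (e ` I)"] fin e that by simp
    then have "Max (e ` I) \<in> (\<Inter>i\<in>I. S i)" by simp
    ultimately show "?L \<le> d"
      by (meson Inf_lower2 image_eqI less_imp_le)
  qed
qed

lemma dF_pullback_eq_Max_dH:
  assumes \<theta>X: "\<And>s. \<theta>X s \<in> carrier (SubPart X)" and \<theta>Y: "\<And>s. \<theta>Y s \<in> carrier (SubPart Y)"
    and tri: "tripod X Y Z \<phi> \<psi>" and ne: "X \<noteq> {}"
  shows "dF Z (\<lambda>t. pullback Z \<phi> (\<theta>X t)) (\<lambda>t. pullback Z \<psi> (\<theta>Y t)) =
    Max {dH (preimage_up X \<theta>X x x') (preimage_up Y \<theta>Y y y') | x y x' y'.
           (x, y) \<in> tripod_rel Z \<phi> \<psi> \<and> (x', y') \<in> tripod_rel Z \<phi> \<psi>}"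
proof -
  have Z: "finite Z" "\<phi> ` Z = X" "\<psi> ` Z = Y" "Z \<noteq> {}"
    using tri ne by (auto simp: tripod_def)
  define S where "S = (\<lambda>(z, w). {\<epsilon>. 0 \<le> \<epsilon> \<and> carried \<theta>X (\<phi> z) (\<phi> w) \<theta>Y (\<psi> z) (\<psi> w) \<epsilon> \<and>
                                    carried \<theta>Y (\<psi> z) (\<psi> w) \<theta>X (\<phi> z) (\<phi> w) \<epsilon>})"
  have dF: "dF Z (\<lambda>t. pullback Z \<phi> (\<theta>X t)) (\<lambda>t. pullback Z \<psi> (\<theta>Y t)) =
      Inf (ereal ` (\<Inter>p\<in>Z \<times> Z. S p))"
  proof -
    have "(0 \<le> \<epsilon> \<and>
       (\<forall>t. pullback Z \<phi> (\<theta>X t) \<sqsubseteq>\<^bsub>SubPart Z\<^esub>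
              \<Squnion>\<^bsub>SubPart Z\<^esub> ((\<lambda>t. pullback Z \<psi> (\<theta>Y t)) ` {t - \<epsilon>..t + \<epsilon>}) \<and>
            pullback Z \<psi> (\<theta>Y t) \<sqsubseteq>\<^bsub>SubPart Z\<^esub>
              \<Squnion>\<^bsub>SubPart Z\<^esub> ((\<lambda>t. pullback Z \<phi> (\<theta>X t)) ` {t - \<epsilon>..t + \<epsilon>}))) \<longleftrightarrow>
      \<epsilon> \<in> (\<Inter>p\<in>Z \<times> Z. S p)" for \<epsilon>
    proof -
      have "\<epsilon> \<in> (\<Inter>p\<in>Z \<times> Z. S p) \<longleftrightarrow> 0 \<le> \<epsilon> \<and>
          (\<forall>z\<in>Z. \<forall>w\<in>Z. carried \<theta>X (\<phi> z) (\<phi> w) \<theta>Y (\<psi> z) (\<psi> w) \<epsilon>) \<and>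
          (\<forall>z\<in>Z. \<forall>w\<in>Z. carried \<theta>Y (\<psi> z) (\<psi> w) \<theta>X (\<phi> z) (\<phi> w) \<epsilon>)"
        using \<open>Z \<noteq> {}\<close> by (auto simp: S_def)
      then show ?thesis
        using pullback_le_join_iff_carried[of \<theta>X X \<theta>Y Y, OF \<theta>X \<theta>Y Z(2,3), of \<epsilon>]
          pullback_le_join_iff_carried[of \<theta>Y Y \<theta>X X, OF \<theta>Y \<theta>X Z(3,2), of \<epsilon>]
        by (simp add: all_conj_distrib)
    qed
    then show ?thesis
      unfolding dF_def by (intro arg_cong[of _ _ Inf]) blast
  qed
  have dH: "dH (preimage_up X \<theta>X (\<phi> z) (\<phi> w)) (preimage_up Y \<theta>Y (\<psi> z) (\<psi> w)) =
      Inf (ereal ` S (z, w))" for z w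
    unfolding dH_def S_def
    by (intro arg_cong[of _ _ Inf])
       (auto simp: preimage_up_subset_thicken_iff[of \<theta>X X \<theta>Y Y, OF \<theta>X \<theta>Y]
          preimage_up_subset_thicken_iff[of \<theta>Y Y \<theta>X X, OF \<theta>Y \<theta>X])
  have "{dH (preimage_up X \<theta>X x x') (preimage_up Y \<theta>Y y y') | x y x' y'.
           (x, y) \<in> tripod_rel Z \<phi> \<psi> \<and> (x', y') \<in> tripod_rel Z \<phi> \<psi>} =
      (\<lambda>(z, w). dH (preimage_up X \<theta>X (\<phi> z) (\<phi> w)) (preimage_up Y \<theta>Y (\<psi> z) (\<psi> w))) ` (Z \<times> Z)"
    by (auto simp: tripod_rel_def) blast+
  also have "\<dots> = (\<lambda>p. Inf (ereal ` S p)) ` (Z \<times> Z)"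
    by (intro image_cong) (auto simp: dH)
  also have "Max \<dots> = Inf (ereal ` (\<Inter>p\<in>Z \<times> Z. S p))"
    using Z by (intro Inf_Inter_upclosed[symmetric]) (auto simp: S_def intro: carried_mono)
  finally show ?thesis
    by (simp add: dF)
qed

lemma tripod_exists:
  assumes "finite X" "X \<noteq> {}" "finite Y" "Y \<noteq> {}"
  shows "\<exists>Z \<phi> \<psi>. tripod X Y Z \<phi> \<psi>"
proof -
  obtain h where "bij_betw h {0..<card (X \<times> Y)} (X \<times> Y)"
    using ex_bij_betw_nat_finite[of "X \<times> Y"] assms by auto
  then have h: "h ` {0..<card (X \<times> Y)} = X \<times> Y"
    by (simp add: bij_betw_def)
  have "tripod X Y {0..<card (X \<times> Y)} (fst \<circ> h) (snd \<circ> h)"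
    unfolding tripod_def image_comp[symmetric] h using assms by simp
  then show ?thesis by blast
qed

text \<open>Different tripods with the same relation yield the same value.\<close>

lemma finite_max_dH_values:
  assumes "finite X" "finite Y"
  shows "finite (max_dH_values X \<theta>X Y \<theta>Y)"
proof -
  define G where "G = (\<lambda>R. Max {dH (preimage_up X \<theta>X x x') (preimage_up Y \<theta>Y y y') | x y x' y'.
                                  (x, y) \<in> R \<and> (x', y') \<in> R})"
  have "max_dH_values X \<theta>X Y \<theta>Y \<subseteq> G ` Pow (X \<times> Y)"
  proof
    fix d assume "d \<in> max_dH_values X \<theta>X Y \<theta>Y"
    then obtain Z \<phi> \<psi> where "tripod X Y Z \<phi> \<psi>" "d = G (tripod_rel Z \<phi> \<psi>)"
      unfolding max_dH_values_def G_def by blast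
    moreover from this have "tripod_rel Z \<phi> \<psi> \<subseteq> X \<times> Y"
      by (auto simp: tripod_def tripod_rel_def)
    ultimately show "d \<in> G ` Pow (X \<times> Y)" by blast
  qed
  then show ?thesis
    using assms by (meson finite_Pow_iff finite_SigmaI finite_imageI finite_subset)
qed

theorem theorem4p23:
  fixes X :: "'a set" and Y :: "'b set"
    and \<theta>X :: "real \<Rightarrow> 'a set set" and \<theta>Y :: "real \<Rightarrow> 'b set set"
  assumes "finite X" and "X \<noteq> {}" and "finite Y" and "Y \<noteq> {}"
    and "formigram X \<theta>X" and "formigram Y \<theta>Y"
  shows "(\<exists>m \<in> GH_values X \<theta>X Y \<theta>Y. \<forall>d \<in> GH_values X \<theta>X Y \<theta>Y. m \<le> d) \<and>
         (\<exists>m \<in> max_dH_values X \<theta>X Y \<theta>Y. \<forall>d \<in> max_dH_values X \<theta>X Y \<theta>Y. m \<le> d) \<and>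
         dGH X \<theta>X Y \<theta>Y = 1 / 2 * (LEAST d. d \<in> max_dH_values X \<theta>X Y \<theta>Y)"
proof -
  let ?V = "max_dH_values X \<theta>X Y \<theta>Y"
  have "\<And>s. \<theta>X s \<in> carrier (SubPart X)" "\<And>s. \<theta>Y s \<in> carrier (SubPart Y)"
    using assms(5,6) by (auto simp: formigram_def)
  note value_eq = dF_pullback_eq_Max_dH[of \<theta>X X \<theta>Y Y, OF this _ assms(2)]
  have GH: "GH_values X \<theta>X Y \<theta>Y = ?V"
    unfolding GH_values_def max_dH_values_def
    by (rule Collect_cong) (metis (no_types, lifting) value_eq)
  have "?V \<noteq> {}"
    using tripod_exists[OF assms(1-4)] by (auto simp: max_dH_values_def)
  moreover have "finite ?V"
    by (rule finite_max_dH_values[OF assms(1,3)])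
  ultimately have "Min ?V \<in> ?V" "\<forall>d\<in>?V. Min ?V \<le> d"
    by (auto intro: Min_in)
  then show ?thesis
    unfolding dGH_def GH by blast
qed

end
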